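(* Let $\mathcal{F}$, $\mathcal{A}$, $\lambda>0$, $\mathcal{G}=\mathcal{F}+\lambda\mathcal{A}$ and the FedAMP iteration be as in the context, and assume that $\mathcal{F}$ and $\mathcal{A}$ are convex functions on $\mathbb{R}^{d\times m}$. Let $W^*$ be an optimal solution of $\min_W \mathcal{G}(W)$ and $\mathcal{G}^*=\mathcal{G}(W^* )$. (i) Let $K\ge 1$ be an integer and let $W^0,\dots,W^K$ be generated by FedAMP with step sizes $\alpha_1=\cdots=\alpha_K=\lambda/\sqrt{K}$. Suppose that there is a constant $B>0$ such that for every iterate $W^k$ $$\max\{\|Y\| : Y\in\partial\mathcal{F}(W^k)\}\le B \quad\text{and}\quad \|\nabla\mathcal{A}(W^k)\|\le B/\lambda .$$ Then $$\min_{0\le k\le K}\mathcal{G}(W^k)\le \mathcal{G}^*+\frac{\|W^0-W^*\|^2+5B^2}{\sqrt{K}}.$$ (ii) Let $(W^k)_{k\ge 0}$ be generated by FedAMP with step sizes $\alpha_k>0$ satisfying $\sum_{k=1}^\infty\alpha_k=\infty$ and $\sum_{k=1}^\infty\alpha_k^2<\infty$. Suppose that there is a constant $B>0$ such that for every $k\ge 0$ one has $\max\{\|Y\| : Y\in\partial\mathcal{F}(W^k)\}\le B$ and $\|\nabla\mathcal{A}(W^k)\|\le B/\lambda$. Then $$\liminf_{k\to\infty}\mathcal{G}(W^k)=\mathcal{G}^*.$$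
   Context: Let $d,m\ge 1$ be integers and $\lambda>0$. For $i=1,\dots,m$ let $F_i:\mathbb{R}^d\to\mathbb{R}$ be a function (training loss of client $i$). For a matrix $W=[w_1,\dots,w_m]\in\mathbb{R}^{d\times m}$ with columns $w_i\in\mathbb{R}^d$, define $$\mathcal{F}(W)=\sum_{i=1}^m F_i(w_i),\qquad \mathcal{A}(W)=\sum_{1\le i<j\le m}A(\|w_i-w_j\|^2),\qquad \mathcal{G}(W)=\mathcal{F}(W)+\lambda\mathcal{A}(W).$$ Here $A:[0,\infty)\to\mathbb{R}$ is a non-linear function (an "attention-inducing" function) such that: $A$ is increasing and concave on $[0,\infty)$ with $A(0)=0$; $A$ is continuously differentiable on $(0,\infty)$; and $\lim_{t\to 0^+}A'(t)$ is finite. The norm $\|\cdot\|$ is the Euclidean norm on vectors and the Frobenius norm on matrices. $\partial\mathcal{F}$ denotes the (convex) subdifferential of $\mathcal{F}$. The optimization problem is $\min_{W\in\mathbb{R}^{d\times m}}\mathcal{G}(W)$. FedAMP iteration: given an arbitrary $W^0\in\mathbb{R}^{d\times m}$ and step sizes $\alpha_k>0$, for $k=1,2,\dots$ set $$U^k=W^{k-1}-\alpha_k\nabla\mathcal{A}(W^{k-1}),\qquad W^k=\arg\min_{W\in\mathbb{R}^{d\times m}}\ \mathcal{F}(W)+\frac{\lambda}{2\alpha_k}\|W-U^k\|^2 .$$ *)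

theory Defs
  imports "HOL-Analysis.Analysis"
begin

text \<open>
  The matrices of size \<open>d \<times> m\<close> are the elements of \<open>real ^ 'm ^ 'd\<close>; the norm of this type is
  the Frobenius norm. The order on \<open>'m\<close> serves only to sum over each unordered pair of clients once.
\<close>

definition attention_inducing :: "(real \<Rightarrow> real) \<Rightarrow> bool" where
  "attention_inducing A \<longleftrightarrow>
     \<not> (\<exists>c. \<forall>t\<ge>0. A t = c * t) \<and>
     mono_on {0..} A \<and> concave_on {0..} A \<and> A 0 = 0 \<and>
     (\<forall>t>0. A differentiable (at t)) \<and> continuous_on {0<..} (deriv A) \<and>
     (\<exists>L. (deriv A \<longlongrightarrow> L) (at_right 0))"

definition total_loss :: "('m \<Rightarrow> real ^ 'd \<Rightarrow> real) \<Rightarrow> real ^ 'm ^ 'd \<Rightarrow> real" where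
  "total_loss F W = (\<Sum>i\<in>UNIV. F i (column i W))"

definition attention ::
    "(real \<Rightarrow> real) \<Rightarrow> real ^ 'm::{finite,linorder} ^ 'd \<Rightarrow> real" where
  "attention A W =
     (\<Sum>(i, j)\<in>{(i, j). i < j}. A ((norm (column i W - column j W))\<^sup>2))"

definition objective ::
    "('m \<Rightarrow> real ^ 'd \<Rightarrow> real) \<Rightarrow> (real \<Rightarrow> real) \<Rightarrow> real \<Rightarrow>
     real ^ 'm::{finite,linorder} ^ 'd \<Rightarrow> real" where
  "objective F A lam W = total_loss F W + lam * attention A W"

definition subdifferential :: "('a::real_inner \<Rightarrow> real) \<Rightarrow> 'a \<Rightarrow> 'a set" where
  "subdifferential f x = {Y. \<forall>z. f z \<ge> f x + Y \<bullet> (z - x)}"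

text \<open>
  Unspecified where \<open>f\<close> has no gradient. For attention-inducing \<open>A\<close> and convex \<open>attention A\<close>
  the gradient exists everywhere: a finite convex function is continuous, so \<open>A\<close> cannot jump
  at \<open>0\<close>, and \<open>x \<mapsto> A (\<parallel>x\<parallel>\<^sup>2)\<close> then has gradient \<open>0\<close> at \<open>0\<close>.
\<close>

definition gradient :: "('a::real_inner \<Rightarrow> real) \<Rightarrow> 'a \<Rightarrow> 'a" where
  "gradient f x = (THE D. GDERIV f x :> D)"

definition fedamp_step ::
    "('m \<Rightarrow> real ^ 'd \<Rightarrow> real) \<Rightarrow> (real \<Rightarrow> real) \<Rightarrow> real \<Rightarrow> real \<Rightarrow>
     real ^ 'm::{finite,linorder} ^ 'd \<Rightarrow> real ^ 'm::{finite,linorder} ^ 'd \<Rightarrow> bool" where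
  "fedamp_step F A lam \<alpha> V W \<longleftrightarrow>
     (let U = V - \<alpha> *\<^sub>R gradient (attention A) V
      in is_arg_min (\<lambda>X. total_loss F X + lam / (2 * \<alpha>) * (norm (X - U))\<^sup>2) (\<lambda>_. True) W)"

end

theory Submission
  imports Defs
begin

text \<open>
  One FedAMP step is a forward-backward step: with \<open>g\<close> the gradient of the attention term at the
  old iterate \<open>V\<close> and \<open>Y\<close> a subgradient of the loss at the new iterate \<open>W\<close>, optimality of the
  proximal step gives \<open>V - W = \<alpha> g + (\<alpha>/\<lambda>) Y\<close>. Expanding the squared distance to an optimum and
  using the two subgradient inequalities bounds the loss at \<open>W\<close> plus \<open>\<lambda>\<close> times the attention at \<open>V\<close>;
  a third one, for the attention at \<open>W\<close>, replaces \<open>V\<close> by \<open>W\<close> at a cost of order \<open>\<alpha>\<^sup>2\<close>. Summing the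
  resulting descent inequality telescopes, and both claims follow.
\<close>

section \<open>Gradients and subgradients of convex functions\<close>

lemma gradient_eqI:
  assumes "GDERIV f x :> D"
  shows "gradient f x = D"
proof -
  have "D' = D" if "GDERIV f x :> D'" for D'
  proof -
    have "(\<lambda>h. h \<bullet> D') = (\<lambda>h. h \<bullet> D)"
      using that assms unfolding gderiv_def by (rule has_derivative_unique)
    then have "\<forall>h. h \<bullet> D' = h \<bullet> D"
      by (simp add: fun_eq_iff)
    then show ?thesis
      by (simp only: vector_eq_ldot)
  qed
  with assms have "(THE D. GDERIV f x :> D) = D"
    by (rule the_equality[where P = "\<lambda>D. GDERIV f x :> D"])
  then show ?thesis
    by (simp only: gradient_def)
qed

lemma differentiable_imp_GDERIV_gradient:
  fixes f :: "'a::euclidean_space \<Rightarrow> real"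
  assumes "f differentiable (at x)"
  shows "GDERIV f x :> gradient f x"
proof -
  obtain f' where f': "(f has_derivative f') (at x)"
    using assms unfolding differentiable_def by blast
  \<comment> \<open>The adjoint maps the reals back into the space; its value at 1 is the vector
    that represents the functional \<open>f'\<close>.\<close>
  have "f' = (\<lambda>h. h \<bullet> adjoint f' 1)"
    using adjoint_works[OF has_derivative_linear[OF f'], of _ 1] by auto
  with f' have "GDERIV f x :> adjoint f' 1"
    unfolding gderiv_def by simp
  then show ?thesis
    using gradient_eqI by metis
qed

text \<open>Restricting \<open>f\<close> to the line through \<open>x\<close> and \<open>y\<close>
  reduces the claim to the tangent inequality in one real variable, read between the parameters 0
  and 1.\<close>

lemma convex_on_gradient_le:
  fixes f :: "'a::real_inner \<Rightarrow> real"
  assumes conv: "convex_on UNIV f" and D: "GDERIV f x :> D"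
  shows "f y \<ge> f x + D \<bullet> (y - x)"
proof -
  define g where "g t = f (x + t *\<^sub>R (y - x))" for t
  have "convex_on UNIV g"
  proof (intro convex_onI)
    fix t a b :: real assume t: "0 < t" "t < 1"
    have eq: "x + ((1 - t) *\<^sub>R a + t *\<^sub>R b) *\<^sub>R (y - x)
        = (1 - t) *\<^sub>R (x + a *\<^sub>R (y - x)) + t *\<^sub>R (x + b *\<^sub>R (y - x))"
      by (simp add: algebra_simps)
    show "g ((1 - t) *\<^sub>R a + t *\<^sub>R b) \<le> (1 - t) * g a + t * g b"
      unfolding g_def eq using t by (intro convex_onD[OF conv]) auto
  qed simp
  moreover have "(g has_real_derivative D \<bullet> (y - x)) (at 0 within UNIV)"
  proof -
    have "((\<lambda>t. x + t *\<^sub>R (y - x)) has_derivative (\<lambda>t. t *\<^sub>R (y - x))) (at (0::real))"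
      by (auto intro!: derivative_eq_intros)
    moreover have "(f has_derivative (\<lambda>h. h \<bullet> D)) (at (x + 0 *\<^sub>R (y - x)))"
      using D by (simp add: gderiv_def)
    ultimately have "(g has_derivative (\<lambda>t. (t *\<^sub>R (y - x)) \<bullet> D)) (at 0)"
      unfolding g_def by (rule has_derivative_compose)
    then show ?thesis
      by (simp add: has_field_derivative_def inner_commute mult.commute[of _ "_ \<bullet> _"])
  qed
  ultimately have "g 1 - g 0 \<ge> D \<bullet> (y - x) * (1 - 0)"
    by (intro convex_on_imp_above_tangent) auto
  then show ?thesis
    by (simp add: g_def)
qed

text \<open>First-order optimality read off directly from the minimum: \<open>w\<close> is compared
  with points on the segment from \<open>w\<close> to \<open>z\<close>, where convexity bounds
  \<open>f\<close>. After division by the parameter \<open>t\<close>, the limit from the right at 0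
  removes the quadratic remainder.\<close>

lemma prox_subgradient:
  fixes f :: "'a::real_inner \<Rightarrow> real"
  assumes conv: "convex_on UNIV f"
    and min: "is_arg_min (\<lambda>x. f x + c / 2 * (norm (x - u))\<^sup>2) (\<lambda>_. True) w"
  shows "c *\<^sub>R (u - w) \<in> subdifferential f w"
proof -
  have "f w + c *\<^sub>R (u - w) \<bullet> (z - w) \<le> f z" for z
  proof (rule tendsto_lowerbound)
    let ?h = "\<lambda>t. f z + c / 2 * t * (norm (z - w))\<^sup>2"
    show "(?h \<longlongrightarrow> f z) (at_right 0)"
      by (auto intro!: tendsto_eq_intros)
    have "f w + c *\<^sub>R (u - w) \<bullet> (z - w) \<le> ?h t" if t: "0 < t" "t < 1" for t
    proof -
      let ?x = "(1 - t) *\<^sub>R w + t *\<^sub>R z"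
      have "f w + c / 2 * (norm (w - u))\<^sup>2 \<le> f ?x + c / 2 * (norm (?x - u))\<^sup>2"
        using min by (auto simp: is_arg_min_def not_less)
      moreover have "f ?x \<le> (1 - t) * f w + t * f z"
        using t by (intro convex_onD[OF conv]) auto
      moreover have "(norm (?x - u))\<^sup>2
          = (norm (w - u))\<^sup>2 - 2 * t * ((u - w) \<bullet> (z - w)) + t\<^sup>2 * (norm (z - w))\<^sup>2"
        unfolding power2_norm_eq_inner
        by (simp add: inner_simps inner_commute algebra_simps power2_eq_square)
      ultimately have "f w + c / 2 * (norm (w - u))\<^sup>2 \<le> (1 - t) * f w + t * f z + c / 2 *
          ((norm (w - u))\<^sup>2 - 2 * t * ((u - w) \<bullet> (z - w)) + t\<^sup>2 * (norm (z - w))\<^sup>2)"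
        by auto
      \<comment> \<open>\<open>f w\<close> and the squared distance from \<open>w\<close> to
        \<open>u\<close> cancel, and every remaining term carries a factor \<open>t\<close>.\<close>
      then have "t * (f w + c * ((u - w) \<bullet> (z - w))) \<le> t * ?h t"
        by (simp only: power2_eq_square[of t]) argo
      with t show ?thesis
        by simp
    qed
    then show "\<forall>\<^sub>F t in at_right 0. f w + c *\<^sub>R (u - w) \<bullet> (z - w) \<le> ?h t"
      unfolding eventually_at_right_field by (intro exI[of _ 1]) auto
  qed simp
  then show ?thesis
    by (simp add: subdifferential_def)
qed

section \<open>Differentiability of the attention term\<close>

text \<open>Away from the origin this is the chain rule. At the origin, a bounded derivative to the
  right of 0 and continuity there give a linear bound on \<open>A\<close>, so the composite is of
  second order in \<open>norm x\<close> and has derivative zero.\<close>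

lemma attention_inducing_sq_differentiable:
  assumes A: "attention_inducing A" and cont: "(A \<longlongrightarrow> 0) (at_right 0)"
  shows "(\<lambda>x::'a::euclidean_space. A ((norm x)\<^sup>2)) differentiable (at x)"
proof (cases "x = 0")
  case False
  then have "A differentiable (at ((norm x)\<^sup>2))"
    using A by (auto simp: attention_inducing_def)
  moreover have "(\<lambda>x::'a. (norm x)\<^sup>2) differentiable (at x)"
    unfolding power2_norm_eq_inner differentiable_def
    using has_derivative_inner[OF has_derivative_ident has_derivative_ident] by blast
  ultimately show ?thesis
    using differentiable_chain_at[of "\<lambda>x::'a. (norm x)\<^sup>2" x A] by (simp add: o_def)
next
  case True
  have A0: "A 0 = 0" and diff: "\<And>t. t > 0 \<Longrightarrow> A differentiable (at t)"
    using A by (auto simp: attention_inducing_def)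
  obtain L where "(deriv A \<longlongrightarrow> L) (at_right 0)"
    using A by (auto simp: attention_inducing_def)
  then have "\<forall>\<^sub>F t in at_right 0. dist (deriv A t) L < 1"
    by (rule tendstoD) simp
  then obtain \<delta> where \<delta>: "\<delta> > 0" "\<And>t. 0 < t \<Longrightarrow> t < \<delta> \<Longrightarrow> dist (deriv A t) L < 1"
    unfolding eventually_at_right_field by auto
  \<comment> \<open>Within distance 1 of its limit \<open>L\<close>, the derivative is at most
    \<open>C\<close> in absolute value on the interval from 0 to \<open>\<delta>\<close>.\<close>
  define C where "C = \<bar>L\<bar> + 1"
  have bound: "\<bar>A t\<bar> \<le> C * t" if t: "0 \<le> t" "t < \<delta>" for t
  proof (cases "t = 0")
    case False
    with t have "0 < t" by simp
    have dA: "(A has_derivative (\<lambda>h. h * deriv A s)) (at s)" if "0 < s" for s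
      using diff[OF that] DERIV_deriv_iff_real_differentiable[of A s]
      by (simp add: has_field_derivative_def mult.commute[of _ "deriv A s"])
    \<comment> \<open>The mean value theorem needs continuity on the closed interval: at 0 it is the
      assumption \<open>cont\<close>, elsewhere it follows from differentiability.\<close>
    have "continuous_on {0..t} A"
      unfolding continuous_on_eq_continuous_within
    proof
      fix s assume s: "s \<in> {0..t}"
      show "continuous (at s within {0..t}) A"
      proof (cases "s = 0")
        case True
        have "(A \<longlongrightarrow> A 0) (at 0 within {0..t})"
          using cont \<open>0 < t\<close> by (simp add: A0 at_within_Icc_at_right)
        with True show ?thesis
          by (simp add: continuous_within)
      next
        case False
        with s show ?thesis
          by (intro continuous_at_imp_continuous_at_within[OF has_derivative_continuous[OF dA]]) auto
      qed
    qed
    then obtain s where s: "0 < s" "s < t" "A t - A 0 = (t - 0) * deriv A s"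
      using mvt[OF \<open>0 < t\<close>, of A "\<lambda>s h. h * deriv A s"] dA by auto
    have "\<bar>deriv A s\<bar> \<le> C"
      using \<delta>(2)[of s] s t by (auto simp: C_def dist_real_def)
    then show ?thesis
      using s \<open>0 < t\<close> by (simp add: A0 abs_mult mult.commute mult_right_mono)
  qed (simp add: A0)
  have "((\<lambda>h::'a. \<bar>A ((norm h)\<^sup>2)\<bar> / norm h) \<longlongrightarrow> 0) (at 0)"
  proof (rule tendsto_sandwich[of "\<lambda>_. 0" _ _ "\<lambda>h. C * norm h"])
    have "\<forall>\<^sub>F h::'a in at 0. dist ((norm h)\<^sup>2) 0 < \<delta>"
      by (rule tendstoD) (auto intro!: tendsto_eq_intros \<delta>(1))
    then show "\<forall>\<^sub>F h::'a in at 0. \<bar>A ((norm h)\<^sup>2)\<bar> / norm h \<le> C * norm h"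
    proof eventually_elim
      case (elim h)
      then have "\<bar>A ((norm h)\<^sup>2)\<bar> \<le> C * (norm h)\<^sup>2"
        by (intro bound) auto
      then show ?case
        by (cases "h = 0") (auto simp: field_simps power2_eq_square)
    qed
  qed (auto intro!: tendsto_eq_intros)
  then have "((\<lambda>x::'a. A ((norm x)\<^sup>2)) has_derivative (\<lambda>_. 0)) (at 0)"
    by (simp add: has_derivative_at A0)
  with True show ?thesis
    unfolding differentiable_def by blast
qed

lemma attention_inducing_nonneg:
  assumes "attention_inducing A" "t \<ge> 0"
  shows "A t \<ge> 0"
proof -
  have "mono_on {0..} A" "A 0 = 0"
    using assms(1) by (auto simp: attention_inducing_def)
  with assms(2) show ?thesis
    using mono_onD[of "{0..}" A 0 t] by simp
qed

text \<open>
  The axioms for \<open>A\<close> alone allow a jump at \<open>0\<close>, and with a single client convexity says nothing about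
  \<open>A\<close>: hence the two distinct clients.
\<close>

lemma convex_attention_imp_tendsto_0:
  fixes i j :: "'m::{finite,linorder}"
  assumes A: "attention_inducing A" and "i < j"
    and conv: "convex_on UNIV (attention A :: real ^ 'm::{finite,linorder} ^ 'd \<Rightarrow> real)"
  shows "(A \<longlongrightarrow> 0) (at_right 0)"
proof -
  have A0: "A 0 = 0"
    using A by (auto simp: attention_inducing_def)
  \<comment> \<open>Only column \<open>i\<close> is nonzero, so multiples of \<open>M\<close>
    separate clients \<open>i\<close> and \<open>j\<close>; scaling by \<open>sqrt (t / r)\<close>
    makes their squared distance exactly \<open>t\<close>.\<close>
  define M :: "real ^ 'm::{finite,linorder} ^ 'd" where "M = (\<chi> k l. if l = i then 1 else 0)"
  define r where "r = (norm (column i M - column j M))\<^sup>2"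
  have "column i M - column j M \<noteq> 0"
    using \<open>i < j\<close> by (auto simp: M_def column_def vec_eq_iff)
  then have r: "r > 0"
    by (simp add: r_def)
  have upper: "A t \<le> attention A (sqrt (t / r) *\<^sub>R M)" if "t > 0" for t
  proof -
    let ?s = "sqrt (t / r)"
    have col: "column l (?s *\<^sub>R M) = ?s *\<^sub>R column l M" for l
      by (simp add: column_def vec_eq_iff)
    have "(norm (column i (?s *\<^sub>R M) - column j (?s *\<^sub>R M)))\<^sup>2 = ?s\<^sup>2 * r"
      by (simp only: col scaleR_diff_right[symmetric] norm_scaleR power_mult_distrib power2_abs) (simp only: r_def)
    also have "\<dots> = t"
      using that r by simp
    \<comment> \<open>The \<open>case\<close> form has the shape of a summand of
      \<open>attention\<close>; since all summands are nonnegative, one of them is at most the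
      sum.\<close>
    finally have "A t = (case (i, j) of (i, j) \<Rightarrow>
        A ((norm (column i (?s *\<^sub>R M) - column j (?s *\<^sub>R M)))\<^sup>2))"
      by simp
    also have "\<dots> \<le> attention A (?s *\<^sub>R M)"
      unfolding attention_def using \<open>i < j\<close>
      by (intro member_le_sum) (auto intro!: attention_inducing_nonneg[OF A])
    finally show ?thesis .
  qed
  \<comment> \<open>Continuity of the convex function makes its values along the multiples of
    \<open>M\<close> tend to 0, and these squeeze \<open>A t\<close> from above.\<close>
  have "continuous_on UNIV (attention A :: real ^ 'm::{finite,linorder} ^ 'd \<Rightarrow> real)"
    by (rule convex_on_continuous[OF open_UNIV conv])
  then have "isCont (attention A) (0 :: real ^ 'm::{finite,linorder} ^ 'd)"
    by (simp add: continuous_on_eq_continuous_at)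
  moreover have "((\<lambda>t. sqrt (t / r) *\<^sub>R M) \<longlongrightarrow> 0) (at_right 0)"
    by (rule tendsto_eq_intros refl | use r in simp)+
  ultimately have "((\<lambda>t. attention A (sqrt (t / r) *\<^sub>R M)) \<longlongrightarrow> attention A (0 :: real ^ 'm::{finite,linorder} ^ 'd)) (at_right 0)"
    by (rule isCont_tendsto_compose)
  moreover have "attention A (0 :: real ^ 'm::{finite,linorder} ^ 'd) = 0"
    by (simp add: attention_def column_def A0 split_def flip: zero_vec_def)
  ultimately show ?thesis
    using upper attention_inducing_nonneg[OF A]
    by (intro tendsto_sandwich[of "\<lambda>_. 0" A "at_right 0" "\<lambda>t. attention A (sqrt (t / r) *\<^sub>R M)"])
      (auto simp: eventually_at_right_field intro!: exI[of _ 1])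
qed

text \<open>Every summand comes from a pair \<open>i < j\<close>, which supplies the two distinct
  clients that continuity of \<open>A\<close> at 0 asks for; with a single client the sum is
  empty.\<close>

lemma convex_attention_differentiable:
  fixes V :: "real ^ 'm::{finite,linorder} ^ 'd"
  assumes A: "attention_inducing A"
    and conv: "convex_on UNIV (attention A :: real ^ 'm::{finite,linorder} ^ 'd \<Rightarrow> real)"
  shows "attention A differentiable (at V)"
proof -
  have lin: "bounded_linear (\<lambda>W :: real ^ 'm::{finite,linorder} ^ 'd. column i W - column j W)" for i j
    unfolding linear_conv_bounded_linear[symmetric]
    by (rule linearI) (auto simp: column_def vec_eq_iff algebra_simps)
  have "(\<lambda>W. A ((norm (column i W - column j W))\<^sup>2)) differentiable (at V)" if "i < j" for i j
    using differentiable_chain_at[OF bounded_linear_imp_differentiable[OF lin]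
        attention_inducing_sq_differentiable[OF A convex_attention_imp_tendsto_0[OF A that conv]]]
    by (simp add: o_def)
  then show ?thesis
    unfolding attention_def by (intro differentiable_sum) auto
qed

section \<open>The descent inequality and its telescoped sum\<close>

lemma forward_backward_descent:
  fixes f a :: "'a::real_inner \<Rightarrow> real"
  assumes lam: "lam > 0" and \<alpha>: "\<alpha> > 0"
    and y: "(lam / \<alpha>) *\<^sub>R (v - \<alpha> *\<^sub>R g - w) \<in> subdifferential f w"
    and g: "g \<in> subdifferential a v" and g': "g' \<in> subdifferential a w"
    and B: "norm ((lam / \<alpha>) *\<^sub>R (v - \<alpha> *\<^sub>R g - w)) \<le> B" "norm g \<le> B / lam" "norm g' \<le> B / lam"
  shows "(norm (w - x))\<^sup>2 + 2 * \<alpha> / lam * ((f w + lam * a w) - (f x + lam * a x))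
    \<le> (norm (v - x))\<^sup>2 + 5 * B\<^sup>2 / lam\<^sup>2 * \<alpha>\<^sup>2"
proof -
  define y where "y = (lam / \<alpha>) *\<^sub>R (v - \<alpha> *\<^sub>R g - w)"
  \<comment> \<open>In these units the step is \<open>\<beta> *\<^sub>R (p + y)\<close>, with both
    directions bounded by the same \<open>B\<close>.\<close>
  define \<beta> where "\<beta> = \<alpha> / lam"
  define p where "p = lam *\<^sub>R g"
  have \<beta>: "\<beta> > 0" and \<alpha>_eq: "\<alpha> = \<beta> * lam"
    using lam \<alpha> by (auto simp: \<beta>_def)
  have vw: "v - w = \<beta> *\<^sub>R (p + y)"
    using lam \<alpha> by (simp add: y_def \<beta>_def p_def algebra_simps)
  have nB: "norm y \<le> B" "norm p \<le> B" "norm (lam *\<^sub>R g') \<le> B"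
    using B lam by (auto simp: y_def p_def field_simps)
  have fx: "f x \<ge> f w + y \<bullet> (x - w)"
    using y by (auto simp: subdifferential_def y_def)
  have ax: "lam * a x \<ge> lam * a v + p \<bullet> (x - v)"
    using g lam mult_left_mono[of "a v + g \<bullet> (x - v)" "a x" lam]
    by (auto simp: subdifferential_def p_def algebra_simps)
  have av: "lam * a v \<ge> lam * a w + (lam *\<^sub>R g') \<bullet> (v - w)"
    using g' lam mult_left_mono[of "a w + g' \<bullet> (v - w)" "a v" lam]
    by (auto simp: subdifferential_def algebra_simps)
  \<comment> \<open>The price of passing from \<open>v\<close> to \<open>w\<close> in the attention
    term: Cauchy-Schwarz with a step of length at most \<open>2 * \<beta> * B\<close>.\<close>
  have "- ((lam *\<^sub>R g') \<bullet> (v - w)) \<le> norm (lam *\<^sub>R g') * norm (v - w)"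
    using Cauchy_Schwarz_ineq2[of "lam *\<^sub>R g'" "v - w"] by linarith
  also have "norm (v - w) \<le> \<beta> * (B + B)"
    unfolding vw using \<beta> nB norm_triangle_ineq[of p y] by simp
  then have "norm (lam *\<^sub>R g') * norm (v - w) \<le> B * (\<beta> * (B + B))"
    using nB norm_ge_zero[of y] by (intro mult_mono) (linarith | simp)+
  finally have cross: "- ((lam *\<^sub>R g') \<bullet> (v - w)) \<le> 2 * \<beta> * B\<^sup>2"
    by (simp add: power2_eq_square algebra_simps)
  have w: "w = v - \<beta> *\<^sub>R (p + y)"
    using vw by (simp add: algebra_simps)
  \<comment> \<open>Pairing \<open>y\<close> with \<open>x - w\<close> instead of
    \<open>x - v\<close> absorbs the mixed term \<open>p \<bullet> y\<close> and reverses the sign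
    of the square of \<open>norm y\<close>, which can then be dropped.\<close>
  have "(norm (w - x))\<^sup>2 = (norm (v - x))\<^sup>2 + 2 * \<beta> * (p \<bullet> (x - v) + y \<bullet> (x - w))
      + \<beta>\<^sup>2 * ((norm p)\<^sup>2 - (norm y)\<^sup>2)"
    unfolding w power2_norm_eq_inner
    by (simp add: inner_simps inner_commute algebra_simps power2_eq_square)
  also have "p \<bullet> (x - v) + y \<bullet> (x - w) \<le> (f x + lam * a x) - (f w + lam * a w) + 2 * \<beta> * B\<^sup>2"
    using fx ax av cross by linarith
  then have "(norm (v - x))\<^sup>2 + 2 * \<beta> * (p \<bullet> (x - v) + y \<bullet> (x - w))
      + \<beta>\<^sup>2 * ((norm p)\<^sup>2 - (norm y)\<^sup>2) \<le> (norm (v - x))\<^sup>2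
      + 2 * \<beta> * ((f x + lam * a x) - (f w + lam * a w) + 2 * \<beta> * B\<^sup>2) + \<beta>\<^sup>2 * B\<^sup>2"
  proof (intro add_mono[OF add_left_mono] mult_left_mono)
    have "(norm p)\<^sup>2 \<le> B\<^sup>2"
      using nB by (intro power_mono) auto
    then show "(norm p)\<^sup>2 - (norm y)\<^sup>2 \<le> B\<^sup>2"
      using zero_le_power2[of "norm y"] by linarith
  qed (use \<beta> in auto)
  \<comment> \<open>The constant is 5 = 4 + 1: four from the change of point, multiplied by
    \<open>2 * \<beta>\<close>, and one from the square of \<open>norm p\<close>.\<close>
  finally have "(norm (w - x))\<^sup>2 + 2 * \<beta> * ((f w + lam * a w) - (f x + lam * a x))
      \<le> (norm (v - x))\<^sup>2 + 5 * B\<^sup>2 * \<beta>\<^sup>2"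
    by (simp add: algebra_simps power2_eq_square)
  then show ?thesis
    by (simp add: \<beta>_def power_divide)
qed

lemma sum_descent_le:
  fixes e b c :: "nat \<Rightarrow> real"
  assumes "\<And>k. k < n \<Longrightarrow> e (Suc k) + b k \<le> e k + c k" and "e n \<ge> 0"
  shows "(\<Sum>k<n. b k) \<le> e 0 + (\<Sum>k<n. c k)"
proof -
  have "(\<Sum>k<n. b k - c k) \<le> (\<Sum>k<n. e k - e (Suc k))"
    using assms(1) by (intro sum_mono) (force simp: algebra_simps)
  also have "\<dots> = e 0 - e n"
    by (rule sum_lessThan_telescope')
  finally show ?thesis
    using assms(2) by (simp add: sum_subtractf)
qed

lemma fedamp_step_descent:
  fixes V W X :: "real ^ 'm::{finite,linorder} ^ 'd"
  assumes lam: "lam > 0" and \<alpha>: "\<alpha> > 0" and A: "attention_inducing A"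
    and convF: "convex_on UNIV (total_loss F)"
    and convA: "convex_on UNIV (attention A :: real ^ 'm::{finite,linorder} ^ 'd \<Rightarrow> real)"
    and step: "fedamp_step F A lam \<alpha> V W"
    and B: "\<And>Y. Y \<in> subdifferential (total_loss F) W \<Longrightarrow> norm Y \<le> B"
      "norm (gradient (attention A) V) \<le> B / lam" "norm (gradient (attention A) W) \<le> B / lam"
  shows "(norm (W - X))\<^sup>2 + 2 * \<alpha> / lam * (objective F A lam W - objective F A lam X)
    \<le> (norm (V - X))\<^sup>2 + 5 * B\<^sup>2 / lam\<^sup>2 * \<alpha>\<^sup>2"
proof -
  have grad: "gradient (attention A) Z \<in> subdifferential (attention A) Z" for Z :: "real ^ 'm::{finite,linorder} ^ 'd"
    using convex_on_gradient_le[OF convA differentiable_imp_GDERIV_gradient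
        [OF convex_attention_differentiable[OF A convA]]]
    by (simp add: subdifferential_def)
  \<comment> \<open>The proximal weight \<open>lam / (2 * \<alpha>)\<close> is \<open>c / 2\<close>
    with \<open>c = lam / \<alpha>\<close>; the subgradient obtained falls under the bound
    \<open>B(1)\<close>.\<close>
  have "(lam / \<alpha>) *\<^sub>R (V - \<alpha> *\<^sub>R gradient (attention A) V - W) \<in> subdifferential (total_loss F) W"
    using step
    by (intro prox_subgradient[OF convF]) (simp add: fedamp_step_def Let_def mult.commute[of 2])
  then show ?thesis
    unfolding objective_def
    using forward_backward_descent[OF lam \<alpha> _ grad grad B(1) B(2,3)] by blast
qed

text \<open>Here \<open>\<alpha> k\<close> leads from \<open>W k\<close> to
  \<open>W (Suc k)\<close>, so step sizes are counted from 0; bounds up to index \<open>n\<close>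
  cover both ends of every step.\<close>

lemma fedamp_sum_le:
  fixes W :: "nat \<Rightarrow> real ^ 'm::{finite,linorder} ^ 'd"
  assumes lam: "lam > 0" and A: "attention_inducing A"
    and convF: "convex_on UNIV (total_loss F)"
    and convA: "convex_on UNIV (attention A :: real ^ 'm::{finite,linorder} ^ 'd \<Rightarrow> real)"
    and \<alpha>: "\<And>k. k < n \<Longrightarrow> \<alpha> k > 0"
    and step: "\<And>k. k < n \<Longrightarrow> fedamp_step F A lam (\<alpha> k) (W k) (W (Suc k))"
    and B: "\<And>k Y. k \<le> n \<Longrightarrow> Y \<in> subdifferential (total_loss F) (W k) \<Longrightarrow> norm Y \<le> B"
      "\<And>k. k \<le> n \<Longrightarrow> norm (gradient (attention A) (W k)) \<le> B / lam"
  shows "(\<Sum>k<n. 2 * \<alpha> k / lam * (objective F A lam (W (Suc k)) - objective F A lam X))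
    \<le> (norm (W 0 - X))\<^sup>2 + (\<Sum>k<n. 5 * B\<^sup>2 / lam\<^sup>2 * (\<alpha> k)\<^sup>2)"
proof (rule sum_descent_le)
  fix k assume "k < n"
  then show "(norm (W (Suc k) - X))\<^sup>2
      + 2 * \<alpha> k / lam * (objective F A lam (W (Suc k)) - objective F A lam X)
    \<le> (norm (W k - X))\<^sup>2 + 5 * B\<^sup>2 / lam\<^sup>2 * (\<alpha> k)\<^sup>2"
    by (intro fedamp_step_descent lam A convF convA \<alpha> step B) auto
qed simp

section \<open>Divergent weights and the limit inferior\<close>

text \<open>If the limit inferior exceeded \<open>l\<close>, the gaps would eventually stay above a
  positive constant. The weighted gaps, summable because they are nonnegative with bounded partial
  sums, would then dominate a multiple of \<open>\<alpha>\<close>, against the divergence of its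
  sum.\<close>

lemma liminf_eq_of_weighted_sum_bounded:
  fixes g :: "nat \<Rightarrow> real"
  assumes \<alpha>: "\<And>k. \<alpha> k > 0" and div: "filterlim (\<lambda>n. \<Sum>k<n. \<alpha> k) at_top sequentially"
    and lower: "\<And>k. g k \<ge> l"
    and bound: "\<And>n. (\<Sum>k<n. \<alpha> k * (g (Suc k) - l)) \<le> M"
  shows "liminf (\<lambda>k. ereal (g k)) = ereal l"
proof (rule antisym)
  show "ereal l \<le> liminf (\<lambda>k. ereal (g k))"
    using lower by (intro Liminf_bounded) simp
  show "liminf (\<lambda>k. ereal (g k)) \<le> ereal l"
  proof (rule ccontr)
    assume "\<not> ?thesis"
    then obtain c where c: "l < c" "ereal c < liminf (\<lambda>k. ereal (g k))"
      using ereal_dense2[of "ereal l"] by (auto simp: not_le)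
    from c(2) have "\<forall>\<^sub>F k in sequentially. c < g k"
      by (auto dest: less_LiminfD)
    then have "\<forall>\<^sub>F k in sequentially. c < g (Suc k)"
      by (rule eventually_sequentially_Suc[THEN iffD2])
    then have ev: "\<forall>\<^sub>F k in sequentially. norm (\<alpha> k) \<le> \<alpha> k * (g (Suc k) - l) / (c - l)"
    proof eventually_elim
      case (elim k)
      then have "\<alpha> k * (c - l) \<le> \<alpha> k * (g (Suc k) - l)"
        using \<alpha>[of k] by (intro mult_left_mono) auto
      then show ?case
        using c(1) \<alpha>[of k] by (simp add: field_simps)
    qed
    have "summable (\<lambda>k. \<alpha> k * (g (Suc k) - l))"
      using \<alpha> lower bound
      by (intro summableI_nonneg_bounded[of _ M] mult_nonneg_nonneg) (auto intro: less_imp_le)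
    then have "summable (\<lambda>k. \<alpha> k * (g (Suc k) - l) / (c - l))"
      by (rule summable_divide)
    with ev have "summable \<alpha>"
      by (rule summable_comparison_test_ev)
    then have "(\<lambda>n. \<Sum>k<n. \<alpha> k) \<longlonglongrightarrow> suminf \<alpha>"
      by (rule summable_LIMSEQ)
    then show False
      using div filterlim_at_top_imp_at_infinity not_tendsto_and_filterlim_at_infinity
        sequentially_bot by blast
  qed
qed

section \<open>The rate for constant steps and the limit for square-summable steps\<close>

theorem theorem1:
  fixes F :: "'m::{finite,linorder} \<Rightarrow> real ^ 'd \<Rightarrow> real"
    and A :: "real \<Rightarrow> real"
    and lam :: real
    and Wopt :: "real ^ 'm::{finite,linorder} ^ 'd"
  assumes "lam > 0"
    and "attention_inducing A"
    and "convex_on UNIV (total_loss F)"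
    and "convex_on UNIV (attention A :: real ^ 'm::{finite,linorder} ^ 'd \<Rightarrow> real)"
    and "is_arg_min (objective F A lam) (\<lambda>_. True) Wopt"
  shows
    "(\<forall>(K::nat) (W :: nat \<Rightarrow> real ^ 'm::{finite,linorder} ^ 'd) (B::real).
        K \<ge> 1 \<longrightarrow>
        (\<forall>k\<in>{1..K}. fedamp_step F A lam (lam / sqrt (real K)) (W (k - 1)) (W k)) \<longrightarrow>
        B > 0 \<longrightarrow>
        (\<forall>k\<le>K. (\<forall>Y\<in>subdifferential (total_loss F) (W k). norm Y \<le> B) \<and>
                norm (gradient (attention A) (W k)) \<le> B / lam) \<longrightarrow>
        (MIN k\<in>{0..K}. objective F A lam (W k))
          \<le> objective F A lam Wopt + ((norm (W 0 - Wopt))\<^sup>2 + 5 * B\<^sup>2) / sqrt (real K))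
     \<and>
     (\<forall>(\<alpha> :: nat \<Rightarrow> real) (W :: nat \<Rightarrow> real ^ 'm::{finite,linorder} ^ 'd) (B::real).
        (\<forall>k\<ge>1. \<alpha> k > 0) \<longrightarrow>
        filterlim (\<lambda>n. \<Sum>k=1..n. \<alpha> k) at_top sequentially \<longrightarrow>
        summable (\<lambda>k. (\<alpha> (Suc k))\<^sup>2) \<longrightarrow>
        (\<forall>k\<ge>1. fedamp_step F A lam (\<alpha> k) (W (k - 1)) (W k)) \<longrightarrow>
        B > 0 \<longrightarrow>
        (\<forall>k. (\<forall>Y\<in>subdifferential (total_loss F) (W k). norm Y \<le> B) \<and>
             norm (gradient (attention A) (W k)) \<le> B / lam) \<longrightarrow>
        liminf (\<lambda>k. ereal (objective F A lam (W k))) = ereal (objective F A lam Wopt))"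
proof -
  let ?G = "objective F A lam"
  note lam = assms(1)
  note sum_le = fedamp_sum_le[OF assms(1-4), where X = Wopt]
  have opt: "?G Wopt \<le> ?G Z" for Z
    using assms(5) by (auto simp: is_arg_min_def not_less)
  show ?thesis
  proof (intro conjI allI impI)
    fix K :: nat and W :: "nat \<Rightarrow> real ^ 'm::{finite,linorder} ^ 'd" and B :: real
    assume K: "K \<ge> 1"
      and step: "\<forall>k\<in>{1..K}. fedamp_step F A lam (lam / sqrt (real K)) (W (k - 1)) (W k)"
      and bnd: "\<forall>k\<le>K. (\<forall>Y\<in>subdifferential (total_loss F) (W k). norm Y \<le> B) \<and>
                norm (gradient (attention A) (W k)) \<le> B / lam"
    let ?\<mu> = "MIN k\<in>{0..K}. ?G (W k)"
    let ?R = "(norm (W 0 - Wopt))\<^sup>2 + 5 * B\<^sup>2"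
    have sK: "sqrt (real K) > 0"
      using K by simp
    \<comment> \<open>With step size \<open>lam / sqrt K\<close> every weight is
      \<open>2 / sqrt K\<close>, and \<open>K\<close> of them add up to
      \<open>2 * sqrt K\<close>.\<close>
    have "real K * (2 * (lam / sqrt (real K)) / lam) = 2 * (real K / sqrt (real K))"
      using lam by simp
    also have "\<dots> = 2 * sqrt (real K)"
      by (simp only: real_div_sqrt of_nat_0_le_iff)
    finally have "2 * sqrt (real K) * (?\<mu> - ?G Wopt)
        = (\<Sum>k<K. 2 * (lam / sqrt (real K)) / lam * (?\<mu> - ?G Wopt))"
      by (simp only: sum_constant card_lessThan mult.assoc[symmetric])
    \<comment> \<open>The sum runs over the iterates 1 to \<open>K\<close>, all of which take part
      in the minimum.\<close>
    also have "\<dots> \<le> (\<Sum>k<K. 2 * (lam / sqrt (real K)) / lam * (?G (W (Suc k)) - ?G Wopt))"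
      using lam by (intro sum_mono mult_left_mono diff_right_mono Min_le) auto
    also have "\<dots> \<le> (norm (W 0 - Wopt))\<^sup>2 + (\<Sum>k<K. 5 * B\<^sup>2 / lam\<^sup>2 * (lam / sqrt (real K))\<^sup>2)"
    proof (intro sum_le)
      fix k assume "k < K"
      then show "fedamp_step F A lam (lam / sqrt (real K)) (W k) (W (Suc k))"
        using step[rule_format, of "Suc k"] by simp
    qed (use bnd lam sK in auto)
    \<comment> \<open>Each of the \<open>K\<close> error terms equals
      \<open>5 * B\<^sup>2 / K\<close>.\<close>
    also have "\<dots> = ?R"
      using lam K by (simp add: power_divide)
    finally have "?\<mu> - ?G Wopt \<le> ?R / (2 * sqrt (real K))"
      using sK by (simp add: field_simps)
    \<comment> \<open>A factor 2 is given away to reach the stated form.\<close>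
    also have "\<dots> \<le> ?R / sqrt (real K)"
      using sK by (intro divide_left_mono) (auto intro!: add_nonneg_nonneg)
    finally show "?\<mu> \<le> ?G Wopt + ?R / sqrt (real K)"
      by simp
  next
    fix \<alpha> :: "nat \<Rightarrow> real" and W :: "nat \<Rightarrow> real ^ 'm::{finite,linorder} ^ 'd" and B :: real
    assume \<alpha>: "\<forall>k\<ge>1. \<alpha> k > 0"
      and div: "filterlim (\<lambda>n. \<Sum>k=1..n. \<alpha> k) at_top sequentially"
      and summ: "summable (\<lambda>k. (\<alpha> (Suc k))\<^sup>2)"
      and step: "\<forall>k\<ge>1. fedamp_step F A lam (\<alpha> k) (W (k - 1)) (W k)"
      and bnd: "\<forall>k. (\<forall>Y\<in>subdifferential (total_loss F) (W k). norm Y \<le> B) \<and>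
             norm (gradient (attention A) (W k)) \<le> B / lam"
    \<comment> \<open>A bound uniform in \<open>n\<close>: the initial squared distance plus the
      total error, finite by summability of the squared step sizes.\<close>
    let ?M = "(norm (W 0 - Wopt))\<^sup>2 + 5 * B\<^sup>2 / lam\<^sup>2 * (\<Sum>k. (\<alpha> (Suc k))\<^sup>2)"
    show "liminf (\<lambda>k. ereal (?G (W k))) = ereal (?G Wopt)"
    proof (rule liminf_eq_of_weighted_sum_bounded)
      \<comment> \<open>The iteration numbers step sizes from 1 and the lemma from 0, hence the
        shift to \<open>\<alpha> (Suc k)\<close>.\<close>
      show "\<alpha> (Suc k) > 0" for k
        using \<alpha> by simp
      show "filterlim (\<lambda>n. \<Sum>k<n. \<alpha> (Suc k)) at_top sequentially"
        using div by (simp add: sum.atLeast1_atMost_eq)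
      show "?G Wopt \<le> ?G (W k)" for k
        by (rule opt)
      fix n
      have "(\<Sum>k<n. 2 * \<alpha> (Suc k) / lam * (?G (W (Suc k)) - ?G Wopt))
          \<le> (norm (W 0 - Wopt))\<^sup>2 + (\<Sum>k<n. 5 * B\<^sup>2 / lam\<^sup>2 * (\<alpha> (Suc k))\<^sup>2)"
      proof (intro sum_le)
        show "fedamp_step F A lam (\<alpha> (Suc k)) (W k) (W (Suc k))" for k
          using step[rule_format, of "Suc k"] by simp
      qed (use bnd \<alpha> in auto)
      also have "\<dots> \<le> ?M"
        unfolding sum_distrib_left[symmetric] using summ
        by (intro add_left_mono mult_left_mono sum_le_suminf) auto
      finally have "2 / lam * (\<Sum>k<n. \<alpha> (Suc k) * (?G (W (Suc k)) - ?G Wopt)) \<le> ?M"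
        by (simp add: sum_distrib_left algebra_simps)
      then show "(\<Sum>k<n. \<alpha> (Suc k) * (?G (W (Suc k)) - ?G Wopt)) \<le> lam / 2 * ?M"
        using lam by (simp add: field_simps)
    qed
  qed
qed

end
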